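(* Let $A$ be a (nonzero) Euclidean metrised algebra, let $c\in A$ be an extremal idempotent, and suppose $\frac12\in\sigma(c)$. Then $\langle z^2;z\rangle=0$ for all $z\in A_c(\frac12)$. In other words, the following fusion rule holds: $$A_c(\tfrac12)\,A_c(\tfrac12)\subset A_c(\tfrac12)^{\perp}.$$
   Context: A Euclidean metrised algebra is a finite-dimensional commutative, not necessarily associative, algebra $A$ over $\mathbb{R}$ with a positive definite symmetric bilinear form $\langle \cdot;\cdot\rangle$ satisfying $\langle xy;z\rangle=\langle x;yz\rangle$ for all $x,y,z\in A$; "nonzero" means that the multiplication is not identically zero. For $x\in A$, $L_x y=xy$. An idempotent is an element $c$ with $c^2=c$; $\sigma(c)$ is the spectrum of $L_c$, $A_c(\lambda)=\ker(L_c-\lambda I)$, and $\perp$ denotes the orthogonal complement with respect to $\langle\cdot;\cdot\rangle$. Extremal idempotents: let $y$ be a point of the unit sphere $\{x\in A:\langle x;x\rangle=1\}$ at which the cubic form $u(x)=\frac16\langle x^2;x\rangle$ attains its global maximum on that sphere; then $y^2=ky$ for some real $k>0$, and $c=y/k$ is a nonzero idempotent. Idempotents obtained in this way are called extremal; equivalently, they are the nonzero idempotents that are global maximum points of $x\mapsto\langle x;x^2\rangle\langle x;x\rangle^{-3/2}$ on $A\setminus\{0\}$. *)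

theory Defs
  imports "HOL-Analysis.Analysis"
begin

(* The underlying finite-dimensional real vector space together with its positive definite
   symmetric bilinear form is the type 'a :: euclidean_space with its inner product; the
   multiplication, which need not be associative, is the parameter m. *)

locale euclidean_metrised_algebra =
  fixes m :: "'a::euclidean_space \<Rightarrow> 'a \<Rightarrow> 'a"
  assumes bilinear_mult: "bilinear m"
    and mult_commute: "m x y = m y x"
    and inner_assoc: "inner (m x y) z = inner x (m y z)"

definition nonzero_mult :: "('a::euclidean_space \<Rightarrow> 'a \<Rightarrow> 'a) \<Rightarrow> bool" where
  "nonzero_mult m \<longleftrightarrow> (\<exists>x y. m x y \<noteq> 0)"

definition cubic_form :: "('a::euclidean_space \<Rightarrow> 'a \<Rightarrow> 'a) \<Rightarrow> 'a \<Rightarrow> real" where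
  "cubic_form m x = (1/6) * inner (m x x) x"

definition extremal_idempotent :: "('a::euclidean_space \<Rightarrow> 'a \<Rightarrow> 'a) \<Rightarrow> 'a \<Rightarrow> bool" where
  "extremal_idempotent m c \<longleftrightarrow>
     (\<exists>y k. inner y y = 1 \<and> (\<forall>x. inner x x = 1 \<longrightarrow> cubic_form m x \<le> cubic_form m y) \<and>
            0 < k \<and> m y y = k *\<^sub>R y \<and> c = y /\<^sub>R k)"

(* L_c is self-adjoint, so all its eigenvalues are real and the real spectrum is the whole
   spectrum. *)
definition mult_spectrum :: "('a::euclidean_space \<Rightarrow> 'a \<Rightarrow> 'a) \<Rightarrow> 'a \<Rightarrow> real set" where
  "mult_spectrum m c = {l. \<not> bij (\<lambda>x. m c x - l *\<^sub>R x)}"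

definition eigenspace :: "('a::euclidean_space \<Rightarrow> 'a \<Rightarrow> 'a) \<Rightarrow> 'a \<Rightarrow> real \<Rightarrow> 'a set" where
  "eigenspace m c l = {x. m c x - l *\<^sub>R x = 0}"

(* The product of two subspaces is the span of the elementwise products. *)
definition subspace_mult ::
    "('a::euclidean_space \<Rightarrow> 'a \<Rightarrow> 'a) \<Rightarrow> 'a set \<Rightarrow> 'a set \<Rightarrow> 'a set" where
  "subspace_mult m V W = span {m x y | x y. x \<in> V \<and> y \<in> W}"

lemma (in euclidean_metrised_algebra) extremal_idempotent_nonzero_idempotent:
  assumes "extremal_idempotent m c"
  shows "c \<noteq> 0" and "m c c = c"
proof -
  obtain y k where *: "inner y y = 1" "0 < k" "m y y = k *\<^sub>R y" "c = y /\<^sub>R k"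
    using assms unfolding extremal_idempotent_def by blast
  show "c \<noteq> 0" using * by auto
  show "m c c = c" using *
    by (simp add: bilinear_lmul[OF bilinear_mult] bilinear_rmul[OF bilinear_mult])
qed

end

theory Submission
  imports Defs
begin

text \<open>Let \<open>c = y / k\<close> with \<open>y\<close> a unit maximum point. Any \<open>z\<close> in the half-eigenspace is orthogonal to
\<open>y\<close>, and the maximality of \<open>y\<close> at \<open>y + t z\<close> reads
\<open>k + (3/2) k t^2 |z|^2 + t^3 <z^2; z> \<le> k (1 + t^2 |z|^2)^(3/2)\<close>. The eigenvalue 1/2 is exactly the one
for which the second-order terms cancel, so \<open>t^3 <z^2; z> \<le> C t^4\<close> for every real \<open>t\<close>,
which forces \<open><z^2; z> = 0\<close>. The fusion rule follows by polarisation.\<close>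

lemma cubic_le_quartic_imp_zero:
  fixes a D :: real
  assumes "0 \<le> D" and le: "\<And>t. t^3 * a \<le> D * t^4"
  shows "a = 0"
proof -
  \<comment> \<open>A single value of \<open>t\<close> replaces the limit \<open>t\<close> to 0: at
    \<open>t = a / E\<close> the bound becomes \<open>a^4 * E <= (E - 1) * a^4\<close>. Taking
    \<open>D + 1\<close> rather than \<open>D\<close> keeps the denominator positive and leaves a
    surplus of \<open>a^4\<close>.\<close>
  define E where "E = D + 1"
  have E: "0 < E" "D = E - 1" using assms(1) by (simp_all add: E_def)
  have "a^4 / E^3 \<le> D * (a^4 / E^4)"
    using le[of "a / E"] by (simp add: power_divide power4_eq_xxxx power3_eq_cube mult.assoc)
  then have "a^4 * E \<le> D * a^4"
    using E(1) by (simp add: field_simps power4_eq_xxxx power3_eq_cube)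
  then have "a^4 \<le> 0" using E(2) by (simp add: algebra_simps)
  then show ?thesis by (metis power_eq_0_iff zero_le_even_power even_numeral order_antisym)
qed

text \<open>The right side is the second-order Taylor polynomial of \<open>(1 + s)^(3/2)\<close> at
  0. Its square exceeds \<open>(1 + s)^3\<close> by exactly
  \<open>s^3 / 8 + 9/64 * s^4\<close>.\<close>

lemma cube_le_of_square_eq:
  fixes r s :: real
  assumes "0 \<le> s" and r2: "r^2 = 1 + s"
  shows "r^3 \<le> 1 + 3/2 * s + 3/8 * s^2"
proof (rule power2_le_imp_le)
  have "(r^3)^2 = (r^2)^3" by (simp flip: power_mult)
  also have "\<dots> = (1 + s)^3" by (simp add: r2)
  also have "\<dots> \<le> (1 + s)^3 + (s^3 / 8 + 9/64 * s^4)" using assms(1) by simp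
  also have "\<dots> = (1 + 3/2 * s + 3/8 * s^2)^2"
    by (simp add: field_simps eval_nat_numeral)
  finally show "(r^3)^2 \<le> (1 + 3/2 * s + 3/8 * s^2)^2" .
  show "0 \<le> 1 + 3/2 * s + 3/8 * s^2" using assms(1) by simp
qed

context euclidean_metrised_algebra
begin

lemmas mult_simps =
  bilinear_ladd[OF bilinear_mult] bilinear_radd[OF bilinear_mult]
  bilinear_lsub[OF bilinear_mult] bilinear_rsub[OF bilinear_mult]
  bilinear_lmul[OF bilinear_mult] bilinear_rmul[OF bilinear_mult]

lemma subspace_eigenspace: "subspace (eigenspace m c l)"
  unfolding subspace_def eigenspace_def
  by (auto simp: mult_simps bilinear_rzero[OF bilinear_mult] algebra_simps)

lemma inner_mult_rotate: "inner (m x y) z = inner (m y z) x"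
  by (metis inner_assoc inner_commute)

text \<open>Commutativity and associativity of the form make \<open>inner (m x y) z\<close>
  symmetric in all three arguments, so the binomial expansion applies.\<close>

lemma inner_cube_add:
  "inner (m (x + y) (x + y)) (x + y)
     = inner (m x x) x + 3 * inner (m x x) y + 3 * inner (m x y) y + inner (m y y) y"
proof -
  have "inner (m x y) x = inner (m x x) y" "inner (m y y) x = inner (m x y) y"
    by (metis inner_mult_rotate mult_commute)+
  then show ?thesis
    by (simp add: mult_simps inner_add_left inner_add_right mult_commute[of y x])
qed

text \<open>Both sides are homogeneous of degree 3 under positive scaling, which reduces
  \<open>x\<close> to the unit sphere.\<close>

lemma inner_cube_le_norm_cube:
  assumes max: "\<And>x. inner x x = 1 \<Longrightarrow> inner (m x x) x \<le> k"
  shows "inner (m x x) x \<le> k * norm x ^ 3"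
proof (cases "x = 0")
  case False
  then have "inner (x /\<^sub>R norm x) (x /\<^sub>R norm x) = 1"
    by (simp add: dot_square_norm power2_eq_square)
  from max[OF this] have "inner (m x x) x / norm x ^ 3 \<le> k"
    by (simp add: mult_simps power3_eq_cube field_simps)
  then show ?thesis using False by (simp add: field_simps)
qed simp

lemma extremal_half_eigenspace_inner_cube:
  assumes "extremal_idempotent m c" and "z \<in> eigenspace m c (1/2)"
  shows "inner (m z z) z = 0"
proof -
  obtain y k where y: "inner y y = 1" "0 < k" "m y y = k *\<^sub>R y" "c = y /\<^sub>R k"
    and max: "\<And>x. inner x x = 1 \<Longrightarrow> cubic_form m x \<le> cubic_form m y"
    using assms(1) unfolding extremal_idempotent_def by blast
  have bound: "inner (m x x) x \<le> k * norm x ^ 3" for x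
    using inner_cube_le_norm_cube[of k] max y(1,3) by (simp add: cubic_form_def)
  have yz: "m y z = (k/2) *\<^sub>R z"
  proof -
    have "m y z = k *\<^sub>R m c z" using y(2,4) by (simp add: mult_simps)
    then show ?thesis using assms(2) by (simp add: eigenspace_def)
  qed
  \<comment> \<open>\<open>y\<close> and \<open>z\<close> are eigenvectors of the self-adjoint map
    \<open>m y\<close> for the distinct eigenvalues \<open>k\<close> and \<open>k/2\<close>.\<close>
  have orth: "inner y z = 0"
  proof -
    have "k * inner y z = inner (m y y) z" using y(3) by simp
    also have "\<dots> = (k/2) * inner y z" by (simp add: inner_assoc yz)
    finally show ?thesis using y(2) by simp
  qed
  define n where "n = inner z z"
  show ?thesis
  proof (rule cubic_le_quartic_imp_zero)
    show "0 \<le> k * (3/8 * n^2)" using y(2) by simp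
    fix t :: real
    have "norm (y + t *\<^sub>R z) ^ 2 = 1 + t^2 * n"
      unfolding power2_norm_eq_inner n_def
      by (simp add: inner_add_left inner_add_right orth inner_commute[of z y] y(1) power2_eq_square)
    then have "norm (y + t *\<^sub>R z) ^ 3 \<le> 1 + 3/2 * (t^2 * n) + 3/8 * (t^2 * n)^2"
      by (intro cube_le_of_square_eq) (simp_all add: n_def)
    then have "inner (m (y + t *\<^sub>R z) (y + t *\<^sub>R z)) (y + t *\<^sub>R z)
        \<le> k * (1 + 3/2 * (t^2 * n) + 3/8 * (t^2 * n)^2)"
      using bound[of "y + t *\<^sub>R z"] y(2) by (meson order_trans mult_left_mono less_imp_le)
    \<comment> \<open>The term linear in \<open>t\<close> vanishes by \<open>orth\<close>. By
      \<open>yz\<close>, the quadratic term \<open>3 * t^2 * inner (m y z) z\<close> equals the one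
      in the upper bound.\<close>
    moreover have "inner (m (y + t *\<^sub>R z) (y + t *\<^sub>R z)) (y + t *\<^sub>R z)
        = k + 3/2 * k * (t^2 * n) + t^3 * inner (m z z) z"
      unfolding inner_cube_add
      by (simp add: mult_simps y(1,3) yz orth n_def power2_eq_square power3_eq_cube)
    ultimately show "t^3 * inner (m z z) z \<le> k * (3/8 * n^2) * t^4"
      by (simp add: algebra_simps power_mult_distrib flip: power_mult)
  qed
qed

lemma inner_mult_zero_if_inner_cube_zero:
  assumes V: "subspace V" and cube: "\<And>x. x \<in> V \<Longrightarrow> inner (m x x) x = 0"
    and "x \<in> V" "y \<in> V" "z \<in> V"
  shows "inner (m x y) z = 0"
proof -
  have sq: "inner (m u u) v = 0" if "u \<in> V" "v \<in> V" for u v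
  proof -
    \<comment> \<open>With the cubes of \<open>u\<close> and \<open>v\<close> zero,
      \<open>u + v\<close> and \<open>u - v\<close> give
      \<open>inner (m u u) v + inner (m u v) v = 0\<close> and
      \<open>- inner (m u u) v + inner (m u v) v = 0\<close>; subtracting isolates the first
      term.\<close>
    have "- v \<in> V" using V that(2) by (rule subspace_neg)
    then have "inner (m (u + v) (u + v)) (u + v) = 0" "inner (m (u + - v) (u + - v)) (u + - v) = 0"
      using that by (simp_all only: cube subspace_add[OF V])
    then show ?thesis
      unfolding inner_cube_add using that cube
      by (simp add: bilinear_lneg[OF bilinear_mult] bilinear_rneg[OF bilinear_mult])
  qed
  show ?thesis
    \<comment> \<open>For \<open>u = x + y\<close> the squares of \<open>x\<close> and
      \<open>y\<close> drop out by \<open>sq\<close>, leaving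
      \<open>2 * inner (m x y) z = 0\<close>.\<close>
    using sq[OF subspace_add[OF V \<open>x \<in> V\<close> \<open>y \<in> V\<close>] \<open>z \<in> V\<close>] sq assms(3-5)
    by (simp add: mult_simps inner_add_left mult_commute[of y x])
qed

lemma subspace_mult_self_orthogonal:
  assumes "subspace V" and "\<And>x. x \<in> V \<Longrightarrow> inner (m x x) x = 0"
  shows "subspace_mult m V V \<subseteq> V\<^sup>\<bottom>"
  unfolding subspace_mult_def
proof (rule span_minimal)
  show "{m x y |x y. x \<in> V \<and> y \<in> V} \<subseteq> V\<^sup>\<bottom>"
    using inner_mult_zero_if_inner_cube_zero[OF assms]
    by (auto simp: orthogonal_comp_def orthogonal_def inner_commute)
qed (rule subspace_orthogonal_comp)

end

theorem proposition6p7: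
  fixes m :: "'a::euclidean_space \<Rightarrow> 'a \<Rightarrow> 'a" and c :: 'a
  assumes "euclidean_metrised_algebra m"
    and "nonzero_mult m"
    and "extremal_idempotent m c"
    and "1/2 \<in> mult_spectrum m c"
  shows "(\<forall>z \<in> eigenspace m c (1/2). inner (m z z) z = 0) \<and>
         subspace_mult m (eigenspace m c (1/2)) (eigenspace m c (1/2))
           \<subseteq> (eigenspace m c (1/2))\<^sup>\<bottom>"
proof -
  interpret euclidean_metrised_algebra m by fact
  show ?thesis
    using extremal_half_eigenspace_inner_cube[OF assms(3)]
      subspace_mult_self_orthogonal[OF subspace_eigenspace] by blast
qed

end
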